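(* Let $G=(V,E)$ be a graph and $v\in V$. Then $$\gamma_{coe}(G)-\deg(v)+1\;\leq\;\gamma_{coe}(G\odot v)\;\leq\;\gamma_{coe}(G)+\deg(v)-1,$$ where $\deg(v)$ is the degree of $v$ in $G$ (the inequalities are between integers).
   Context: All graphs are finite and simple. For a graph $G=(V,E)$, the degree $\deg(u)$ of a vertex $u$ is the number of vertices adjacent to $u$. A set $D\subseteq V$ is a dominating set of $G$ if every vertex of $V-D$ is adjacent to at least one vertex of $D$. A dominating set $D$ is a co-even dominating set of $G$ if $\deg(u)$ (degree in $G$) is even for every $u\in V-D$. The co-even domination number $\gamma_{coe}(G)$ is the minimum cardinality of a co-even dominating set of $G$. For $v\in V$, the graph $G\odot v$ is obtained from $G$ by removing all edges between any pair of neighbours of $v$; the vertex $v$ itself and its incident edges are not removed.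
   Formalization: The vertex v is additionally assumed to have degree at least 1; for an isolated vertex, G⊙v = G and deg(v) = 0, so both stated inequalities would be false. *)

theory Defs
  imports "Graph_Theory.Pair_Digraph"
begin

text \<open>
  A finite simple graph is a \<^locale>\<open>pair_graph\<close>: finite vertex set, irreflexive symmetric
  arc relation. Each undirected edge is represented by its two arcs.
\<close>

definition neighbours :: "'a pair_pre_digraph \<Rightarrow> 'a \<Rightarrow> 'a set" where
  "neighbours G u = {w. (u, w) \<in> parcs G}"

definition deg :: "'a pair_pre_digraph \<Rightarrow> 'a \<Rightarrow> nat" where
  "deg G u = card (neighbours G u)"

definition dominating_set :: "'a pair_pre_digraph \<Rightarrow> 'a set \<Rightarrow> bool" where
  "dominating_set G D \<longleftrightarrow>
     D \<subseteq> pverts G \<and> (\<forall>u \<in> pverts G - D. \<exists>w \<in> D. (u, w) \<in> parcs G)"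

definition coeven_dominating_set :: "'a pair_pre_digraph \<Rightarrow> 'a set \<Rightarrow> bool" where
  "coeven_dominating_set G D \<longleftrightarrow>
     dominating_set G D \<and> (\<forall>u \<in> pverts G - D. even (deg G u))"

definition coeven_domination_number :: "'a pair_pre_digraph \<Rightarrow> nat" (\<open>\<gamma>\<^sub>c\<^sub>o\<^sub>e\<close>) where
  "\<gamma>\<^sub>c\<^sub>o\<^sub>e G = Min (card ` {D. coeven_dominating_set G D})"

definition odot :: "'a pair_pre_digraph \<Rightarrow> 'a \<Rightarrow> 'a pair_pre_digraph" (infixl \<open>\<odot>\<close> 70) where
  "G \<odot> v = G\<lparr>parcs := parcs G - neighbours G v \<times> neighbours G v\<rparr>"

lemma pair_graph_odot:
  assumes "pair_graph G"
  shows "pair_graph (G \<odot> v)"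
proof -
  interpret pair_graph G by fact
  have "(b, a) \<in> parcs G" if "(a, b) \<in> parcs G" for a b
    using arcs_ends_symmetric[OF pair_sym_arcs] that by simp
  then have "symmetric (with_proj (G \<odot> v))"
    by (auto simp: symmetric_def sym_def odot_def)
  then show ?thesis
    by unfold_locales
      (auto simp: odot_def dest: wellformed' pair_no_loops intro: pair_finite_verts pair_finite_arcs)
qed

lemma neighbours_odot_self:
  assumes "pair_graph G"
  shows "neighbours (G \<odot> v) v = neighbours G v"
proof -
  interpret pair_graph G by fact
  show ?thesis by (auto simp: neighbours_def odot_def dest: pair_no_loops)
qed

text \<open>The minimum is over a finite nonempty set of cardinalities, so it is attained.\<close>

lemma coeven_domination_number_attained:
  assumes "pair_graph G"
  shows "\<exists>D. coeven_dominating_set G D \<and> card D = \<gamma>\<^sub>c\<^sub>o\<^sub>e G"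
    and "coeven_dominating_set G D \<Longrightarrow> \<gamma>\<^sub>c\<^sub>o\<^sub>e G \<le> card D"
proof -
  interpret pair_graph G by fact
  have "{D. coeven_dominating_set G D} \<subseteq> Pow (pverts G)"
    by (auto simp: coeven_dominating_set_def dominating_set_def)
  then have fin: "finite (card ` {D. coeven_dominating_set G D})"
    by (meson finite_Pow_iff finite_imageI finite_subset pair_finite_verts)
  have "coeven_dominating_set G (pverts G)"
    by (auto simp: coeven_dominating_set_def dominating_set_def)
  then have "card ` {D. coeven_dominating_set G D} \<noteq> {}"
    by blast
  from Min_in[OF fin this] show "\<exists>D. coeven_dominating_set G D \<and> card D = \<gamma>\<^sub>c\<^sub>o\<^sub>e G"
    by (auto simp: coeven_domination_number_def)
  show "coeven_dominating_set G D \<Longrightarrow> \<gamma>\<^sub>c\<^sub>o\<^sub>e G \<le> card D"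
    by (auto simp: coeven_domination_number_def intro: Min_le[OF fin])
qed

text \<open>
  For an isolated vertex the bounds
  \<open>\<gamma>\<^sub>c\<^sub>o\<^sub>e G - deg G v + 1 \<le> \<gamma>\<^sub>c\<^sub>o\<^sub>e (G \<odot> v) \<le> \<gamma>\<^sub>c\<^sub>o\<^sub>e G + deg G v - 1\<close> both fail,
  so they can only hold for a vertex of positive degree.
\<close>

lemma isolated_vertex_bounds_fail:
  assumes "pair_graph G" and "deg G v = 0"
  shows "\<not> int (\<gamma>\<^sub>c\<^sub>o\<^sub>e G) - int (deg G v) + 1 \<le> int (\<gamma>\<^sub>c\<^sub>o\<^sub>e (G \<odot> v))"
    and "\<not> int (\<gamma>\<^sub>c\<^sub>o\<^sub>e (G \<odot> v)) \<le> int (\<gamma>\<^sub>c\<^sub>o\<^sub>e G) + int (deg G v) - 1"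
proof -
  interpret pair_graph G by fact
  have "neighbours G v \<subseteq> pverts G"
    by (auto simp: neighbours_def dest: wellformed')
  then have "neighbours G v = {}"
    using assms(2) pair_finite_verts by (simp add: deg_def finite_subset)
  then have "G \<odot> v = G"
    by (simp add: odot_def)
  then show "\<not> int (\<gamma>\<^sub>c\<^sub>o\<^sub>e G) - int (deg G v) + 1 \<le> int (\<gamma>\<^sub>c\<^sub>o\<^sub>e (G \<odot> v))"
    and "\<not> int (\<gamma>\<^sub>c\<^sub>o\<^sub>e (G \<odot> v)) \<le> int (\<gamma>\<^sub>c\<^sub>o\<^sub>e G) + int (deg G v) - 1"
    using assms(2) by simp_all
qed

end

theory Submission
  imports Defs
begin

text \<open>
  Let \<open>N\<close> be the neighbourhood of \<open>v\<close>. The passage between \<open>G\<close> and \<open>G \<odot> v\<close> only changes arcs inside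
  \<open>N\<close>, so both inequalities are instances of one statement about two graphs that agree outside
  \<open>N \<times> N\<close>. Given a co-even dominating set \<open>D\<close> of the first, \<open>D \<union> N\<close> serves the second, and it is small
  enough if \<open>D\<close> meets \<open>N\<close>. Otherwise \<open>v \<in> D\<close> and all vertices of \<open>N\<close> have even degree. If \<open>deg v\<close> is
  even, drop \<open>v\<close> from \<open>D \<union> N\<close>. If \<open>deg v = card N\<close> is odd, the handshake lemma inside \<open>N\<close> yields some
  \<open>u \<in> N\<close> whose degree has the same parity in both graphs; drop \<open>u\<close>, which \<open>v\<close> dominates.
\<close>

text \<open>Handshake lemma for the subgraph induced on \<open>N\<close>. By symmetry, a new vertex
  \<open>x\<close> contributes its number of neighbours in \<open>N\<close> twice: once as its own
  term, once spread over the terms of those neighbours.\<close>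

lemma even_sum_card_symmetric:
  assumes "finite N" and "sym R" and "irrefl R"
  shows "even (\<Sum>u\<in>N. card {w \<in> N. (u, w) \<in> R})"
  using assms(1)
proof (induction N)
  case empty
  show ?case by simp
next
  case (insert x N)
  \<comment> \<open>This covers \<open>u = x\<close> as well, where irreflexivity later makes the
    extra summand 0.\<close>
  have *: "card {w \<in> insert x N. (u, w) \<in> R}
      = card {w \<in> N. (u, w) \<in> R} + (if (x, u) \<in> R then 1 else 0)" for u
  proof (cases "(x, u) \<in> R")
    case True
    then have "{w \<in> insert x N. (u, w) \<in> R} = insert x {w \<in> N. (u, w) \<in> R}"
      using assms(2) by (auto dest: symD)
    then show ?thesis using True insert by simp
  next
    case False
    then have "{w \<in> insert x N. (u, w) \<in> R} = {w \<in> N. (u, w) \<in> R}"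
      using assms(2) by (auto dest: symD)
    then show ?thesis using False by simp
  qed
  have "(x, x) \<notin> R" using assms(3) by (simp add: irrefl_def)
  moreover have "(\<Sum>u\<in>N. if (x, u) \<in> R then 1 else 0) = card {w \<in> N. (x, w) \<in> R}"
    using insert by (simp add: sum.If_cases Int_def)
  ultimately have "(\<Sum>u\<in>insert x N. card {w \<in> insert x N. (u, w) \<in> R})
      = 2 * card {w \<in> N. (x, w) \<in> R} + (\<Sum>u\<in>N. card {w \<in> N. (u, w) \<in> R})"
    using insert by (simp only: * sum.insert sum.distrib) simp
  then show ?case using insert by simp
qed

lemma finite_neighbours:
  assumes "pair_graph G"
  shows "finite (neighbours G u)"
proof -
  interpret pair_graph G by fact
  have "neighbours G u \<subseteq> pverts G"
    by (auto simp: neighbours_def dest: wellformed')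
  then show ?thesis by (rule finite_subset) simp
qed

lemma pair_graph_sym_irrefl:
  assumes "pair_graph G"
  shows "sym (parcs G)" and "irrefl (parcs G)"
proof -
  interpret pair_graph G by fact
  show "sym (parcs G)"
    using arcs_ends_symmetric[OF pair_sym_arcs] by (auto intro: symI)
  show "irrefl (parcs G)"
    by (auto simp: irrefl_def dest: pair_no_loops)
qed

text \<open>Isolates the part of the degree that can change: if two graphs agree outside
  \<open>N \<times> N\<close>, only the first summand can differ between them.\<close>

lemma deg_split:
  assumes "pair_graph G"
  shows "deg G u = card {w \<in> N. (u, w) \<in> parcs G} + card {w. w \<notin> N \<and> (u, w) \<in> parcs G}"
proof -
  have "neighbours G u = {w \<in> N. (u, w) \<in> parcs G} \<union> {w. w \<notin> N \<and> (u, w) \<in> parcs G}"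
    by (auto simp: neighbours_def)
  moreover from this have "finite {w \<in> N. (u, w) \<in> parcs G}"
    and "finite {w. w \<notin> N \<and> (u, w) \<in> parcs G}"
    using finite_neighbours[OF assms, of u] by auto
  ultimately show ?thesis
    unfolding deg_def by (simp, subst card_Un_disjoint) auto
qed

text \<open>If every vertex of \<open>N\<close> changed parity, adding the inner degrees of both
  graphs over \<open>N\<close> would sum an odd number of odd terms, yet each graph contributes an
  even total by the handshake lemma.\<close>

lemma odd_card_obtains_same_parity:
  assumes G: "pair_graph G" and H: "pair_graph H"
    and "finite N" and "odd (card N)"
    and agree: "parcs G - N \<times> N = parcs H - N \<times> N"
  obtains u where "u \<in> N" and "even (deg G u) \<longleftrightarrow> even (deg H u)"
proof -
  let ?inner = "\<lambda>K u. card {w \<in> N. (u, w) \<in> parcs K}"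
  have "\<exists>u \<in> N. even (deg G u) \<longleftrightarrow> even (deg H u)"
  proof (rule ccontr)
    assume *: "\<not> ?thesis"
    have "odd (?inner G u + ?inner H u)" if "u \<in> N" for u
    proof -
      have "{w. w \<notin> N \<and> (u, w) \<in> parcs G} = {w. w \<notin> N \<and> (u, w) \<in> parcs H}"
        using agree by blast
      then show ?thesis
        using * that deg_split[OF G, of u N] deg_split[OF H, of u N] by auto
    qed
    then have "{u \<in> N. odd (?inner G u + ?inner H u)} = N"
      by blast
    then have "odd (\<Sum>u\<in>N. ?inner G u + ?inner H u)"
      using even_sum_iff[OF \<open>finite N\<close>, of "\<lambda>u. ?inner G u + ?inner H u"] \<open>odd (card N)\<close> by simp
    moreover have "even (\<Sum>u\<in>N. ?inner G u + ?inner H u)"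
      using even_sum_card_symmetric[OF \<open>finite N\<close>] pair_graph_sym_irrefl[OF G]
        pair_graph_sym_irrefl[OF H]
      by (simp add: sum.distrib)
    ultimately show False by blast
  qed
  then show ?thesis using that by blast
qed

text \<open>The hypotheses are symmetric in \<open>G\<close> and \<open>H\<close>, so swapping the
  two graphs yields the other inequality. The additive form avoids truncated subtraction on
  naturals.\<close>

lemma coeven_domination_number_le_of_agree:
  assumes G: "pair_graph G" and H: "pair_graph H"
    and "pverts G = pverts H"
    and agree: "parcs G - N \<times> N = parcs H - N \<times> N"
    and nG: "neighbours G v = N" and nH: "neighbours H v = N"
    and v: "v \<in> pverts G" and "N \<noteq> {}"
  shows "\<gamma>\<^sub>c\<^sub>o\<^sub>e H + 1 \<le> \<gamma>\<^sub>c\<^sub>o\<^sub>e G + card N"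
proof -
  interpret G: pair_graph G by fact
  obtain D where D: "coeven_dominating_set G D" and card_D: "card D = \<gamma>\<^sub>c\<^sub>o\<^sub>e G"
    using coeven_domination_number_attained(1)[OF G] by blast
  have sub: "D \<subseteq> pverts G"
    and dom: "\<And>u. u \<in> pverts G \<Longrightarrow> u \<notin> D \<Longrightarrow> \<exists>w \<in> D. (u, w) \<in> parcs G"
    and evn: "\<And>u. u \<in> pverts G \<Longrightarrow> u \<notin> D \<Longrightarrow> even (deg G u)"
    using D by (auto simp: coeven_dominating_set_def dominating_set_def)
  have fin: "finite N" "finite D"
    using finite_neighbours[OF G, of v] nG sub finite_subset[OF _ G.pair_finite_verts] by auto
  have N_sub: "N \<subseteq> pverts G"
    using nG by (auto simp: neighbours_def dest: G.wellformed')
  have "v \<notin> N"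
    using nG by (auto simp: neighbours_def dest: G.pair_no_loops)
  have arc: "(u, w) \<in> parcs H \<longleftrightarrow> (u, w) \<in> parcs G" if "u \<notin> N" for u w
    using agree that by blast
  then have deg_eq: "deg H u = deg G u" if "u \<notin> N" for u
    using that by (simp add: deg_def neighbours_def)
  have v_arc: "(u, v) \<in> parcs K" if "u \<in> N" and "K = G \<or> K = H" for u K
    using that nG nH pair_graph_sym_irrefl(1)[OF G] pair_graph_sym_irrefl(1)[OF H]
    by (auto simp: neighbours_def dest: symD)
  have v_nb: "u \<in> N" if "(u, v) \<in> parcs G" for u
    using that nG pair_graph_sym_irrefl(1)[OF G] by (auto simp: neighbours_def dest: symD)
  have "\<exists>D'. coeven_dominating_set H D' \<and> card D' + 1 \<le> card D + card N"
  proof (cases "D \<inter> N = {}")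
    case False
    \<comment> \<open>A vertex outside \<open>N\<close> has the same arcs in both graphs, so it
      keeps its dominator and its degree.\<close>
    have "coeven_dominating_set H (D \<union> N)"
      unfolding coeven_dominating_set_def dominating_set_def
    proof (intro conjI ballI)
      show "D \<union> N \<subseteq> pverts H" using sub N_sub \<open>pverts G = pverts H\<close> by auto
    next
      fix u assume u: "u \<in> pverts H - (D \<union> N)"
      then obtain w where "w \<in> D" "(u, w) \<in> parcs G"
        using dom \<open>pverts G = pverts H\<close> by auto
      then show "\<exists>w \<in> D \<union> N. (u, w) \<in> parcs H" using u arc[of u w] by auto
      show "even (deg H u)" using u evn deg_eq \<open>pverts G = pverts H\<close> by auto
    qed
    moreover have "card (D \<inter> N) \<ge> 1"
      using False fin by (simp add: Suc_le_eq card_gt_0_iff)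
    then have "card (D \<union> N) + 1 \<le> card D + card N"
      using card_Un_Int[OF fin(2,1)] by simp
    ultimately show ?thesis by blast
  next
    case True
    \<comment> \<open>Otherwise a dominator of \<open>v\<close> would lie in both \<open>D\<close>
      and \<open>N\<close>.\<close>
    have "v \<in> D"
    proof (rule ccontr)
      assume "v \<notin> D"
      then obtain w where "w \<in> D" "(v, w) \<in> parcs G" using dom[of v] v by auto
      then show False using True nG by (auto simp: neighbours_def)
    qed
    have card_Un: "card (D \<union> N) = card D + card N"
      using fin True by (simp add: card_Un_disjoint)
    show ?thesis
    proof (cases "even (card N)")
      case even: True
      \<comment> \<open>\<open>v\<close> has even degree \<open>card N\<close> and is dominated by
        any element of \<open>N\<close>. No other vertex outside the set relied on \<open>v\<close>,
        since all neighbours of \<open>v\<close> lie in \<open>N\<close>.\<close>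
      have "coeven_dominating_set H (D \<union> N - {v})"
        unfolding coeven_dominating_set_def dominating_set_def
      proof (intro conjI ballI)
        show "D \<union> N - {v} \<subseteq> pverts H" using sub N_sub \<open>pverts G = pverts H\<close> by auto
      next
        fix u assume u: "u \<in> pverts H - (D \<union> N - {v})"
        show "\<exists>w \<in> D \<union> N - {v}. (u, w) \<in> parcs H"
        proof (cases "u = v")
          case True
          then show ?thesis
            using \<open>N \<noteq> {}\<close> \<open>v \<notin> N\<close> nH by (auto simp: neighbours_def)
        next
          case False
          then obtain w where "w \<in> D" "(u, w) \<in> parcs G"
            using u dom[of u] \<open>pverts G = pverts H\<close> by auto
          moreover have "u \<notin> N" using u False by blast
          ultimately show ?thesis using v_nb[of u] arc[of u w] by auto
        qed
        show "even (deg H u)"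
          using u evn deg_eq even \<open>v \<notin> N\<close> nH \<open>pverts G = pverts H\<close>
          by (cases "u = v") (auto simp: deg_def)
      qed
      moreover have "card (D \<union> N - {v}) + 1 = card (D \<union> N)"
        using card_Suc_Diff1[of "D \<union> N" v] fin \<open>v \<in> D\<close> by simp
      ultimately show ?thesis using card_Un by (metis order_refl)
    next
      case odd: False
      obtain x where x: "x \<in> N" "even (deg G x) \<longleftrightarrow> even (deg H x)"
        using odd_card_obtains_same_parity[OF G H fin(1) odd agree] by blast
      \<comment> \<open>As \<open>x\<close> is not in \<open>D\<close>, its degree is even in
        \<open>G\<close>, hence in \<open>H\<close>; and dominators taken from \<open>D\<close>
        survive the removal of \<open>x\<close>.\<close>
      have "coeven_dominating_set H (D \<union> N - {x})"
        unfolding coeven_dominating_set_def dominating_set_def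
      proof (intro conjI ballI)
        show "D \<union> N - {x} \<subseteq> pverts H" using sub N_sub \<open>pverts G = pverts H\<close> by auto
      next
        fix u assume u: "u \<in> pverts H - (D \<union> N - {x})"
        show "\<exists>w \<in> D \<union> N - {x}. (u, w) \<in> parcs H"
        proof (cases "u = x")
          case True
          then show ?thesis using v_arc[of x H] x \<open>v \<in> D\<close> \<open>v \<notin> N\<close> by auto
        next
          case False
          then obtain w where "w \<in> D" "(u, w) \<in> parcs G"
            using u dom[of u] \<open>pverts G = pverts H\<close> by auto
          moreover have "u \<notin> N" using u False by blast
          moreover have "w \<noteq> x" using \<open>w \<in> D\<close> x True \<open>D \<inter> N = {}\<close> by blast
          ultimately show ?thesis using arc[of u w] by auto
        qed
        show "even (deg H u)"
        proof (cases "u = x")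
          case True
          then show ?thesis using x evn[of x] N_sub \<open>D \<inter> N = {}\<close> by auto
        next
          case False
          then show ?thesis using u evn deg_eq \<open>pverts G = pverts H\<close> by auto
        qed
      qed
      moreover have "card (D \<union> N - {x}) + 1 = card (D \<union> N)"
        using card_Suc_Diff1[of "D \<union> N" x] fin x by simp
      ultimately show ?thesis using card_Un by (metis order_refl)
    qed
  qed
  then show ?thesis
    using coeven_domination_number_attained(2)[OF H] card_D by fastforce
qed

theorem theorem2p2:
  fixes G :: "'a pair_pre_digraph" and v :: 'a
  assumes "pair_graph G"
    and "v \<in> pverts G"
    and "deg G v \<ge> 1"
  shows "int (\<gamma>\<^sub>c\<^sub>o\<^sub>e G) - int (deg G v) + 1 \<le> int (\<gamma>\<^sub>c\<^sub>o\<^sub>e (G \<odot> v)) \<and>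
         int (\<gamma>\<^sub>c\<^sub>o\<^sub>e (G \<odot> v)) \<le> int (\<gamma>\<^sub>c\<^sub>o\<^sub>e G) + int (deg G v) - 1"
proof -
  let ?N = "neighbours G v"
  have H: "pair_graph (G \<odot> v)" and nH: "neighbours (G \<odot> v) v = ?N"
    using assms(1) by (rule pair_graph_odot, rule neighbours_odot_self)
  have verts: "pverts (G \<odot> v) = pverts G"
    and agree: "parcs (G \<odot> v) - ?N \<times> ?N = parcs G - ?N \<times> ?N"
    by (auto simp: odot_def)
  \<comment> \<open>Positive degree enters here; for an isolated vertex both bounds fail.\<close>
  have "?N \<noteq> {}" using assms(3) by (auto simp: deg_def)
  then have "\<gamma>\<^sub>c\<^sub>o\<^sub>e G + 1 \<le> \<gamma>\<^sub>c\<^sub>o\<^sub>e (G \<odot> v) + deg G v"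
    and "\<gamma>\<^sub>c\<^sub>o\<^sub>e (G \<odot> v) + 1 \<le> \<gamma>\<^sub>c\<^sub>o\<^sub>e G + deg G v"
    using coeven_domination_number_le_of_agree[OF H assms(1) verts agree nH refl]
      coeven_domination_number_le_of_agree[OF assms(1) H verts[symmetric] agree[symmetric] refl nH]
      assms(2) verts
    by (simp_all add: deg_def)
  then show ?thesis by linarith
qed

end
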